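(* Let $\rho:[1,\infty)\to(0,1]$ be a decreasing bijection. Then there exists a distribution over one-dimensional stochastic optimization problem instances $(f,P_V)$ (a fixed sample objective $f:\mathbb R\times\mathcal S\to\mathbb R$ and a random distribution $P_V$ on $\mathcal S$ indexed by a random variable $V$), each realization $(f,P_v)$ of which satisfies $\mathbf{dist}(\mathbf 0,\arg\min F_{f,P_v})\le1$ and has $f(\cdot;s)$ convex and $1$-Lipschitz for all $s\in\mathcal S$, such that for any stochastic optimization method that samples $n$ functions from $(f,P_V)$ and outputs $x^{\mathrm{out}}_n$, $$\limsup_{n\to\infty}\frac{n^{1/2}\,\mathbb E\big[F_{f,P_V}(x^{\mathrm{out}}_n)-F^\star_{f,P_V}\big]}{\rho(n)}\ \ge\ \frac16 .$$
   Context: A stochastic optimization problem instance $(f,P)$ consists of a distribution $P$ on a sample space $\mathcal S$ and a sample objective $f$; $F_{f,P}(x):=\mathbb E_{S\sim P}f(x;S)$ and $F^\star_{f,P}:=\min_xF_{f,P}(x)$. $\mathbf{dist}(x,A)=\inf_{y\in A}\|x-y\|$ ($=\infty$ if $A=\emptyset$). A stochastic optimization method has unrestricted access to the sample objective $f$ but observes $P$ only through samples: its output after $n$ samples is $x^{\mathrm{out}}_n=\mathrm A_n(f,U,S^{(1)},\dots,S^{(n)})$, where $\mathrm A_n$ ($n\in\mathbb N$) is a measurable mapping into the domain, $S^{(1)},\dots,S^{(n)}$ are (conditionally on $V$) i.i.d. from $P_V$, and $U\sim\mathsf{Unif}([0,1])$ is independent of the samples (and of $V$). The expectation is over $V$,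 the samples and $U$. *)

theory Defs
  imports "HOL-Probability.Probability"
begin

text \<open>
  A distribution over stochastic optimization problem instances is given by a measurable space
  \<open>M\<close> of samples, a sample objective \<open>f\<close>, the law \<open>Q\<close> of a random index \<open>V\<close>, and a probability
  kernel \<open>P\<close> from \<open>Q\<close> to \<open>M\<close>; the realization at \<open>V = v\<close> is the instance \<open>(f, P v)\<close>.
\<close>

definition objective :: "('x \<Rightarrow> 's \<Rightarrow> real) \<Rightarrow> 's measure \<Rightarrow> 'x \<Rightarrow> real"
  where "objective f P x = (\<integral>s. f x s \<partial>P)"

definition argmin_set :: "('x \<Rightarrow> real) \<Rightarrow> 'x set"
  where "argmin_set F = {x. is_arg_min F (\<lambda>_. True) x}"

text \<open>The real-valued infimum is the minimum whenever \<^term>\<open>argmin_set (objective f P)\<close> is nonempty.\<close>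

definition min_objective :: "('x \<Rightarrow> 's \<Rightarrow> real) \<Rightarrow> 's measure \<Rightarrow> real"
  where "min_objective f P = (INF x. objective f P x)"

text \<open>
  Unlike \<^const>\<open>infdist\<close>, which is \<open>0\<close> for the empty set, this distance to the empty set
  is \<open>\<infinity>\<close>.
\<close>

definition set_distance :: "'x::metric_space \<Rightarrow> 'x set \<Rightarrow> ereal"
  where "set_distance x A = (INF y\<in>A. ereal (dist x y))"

definition instance_distribution ::
    "'s measure \<Rightarrow> ('x \<Rightarrow> 's \<Rightarrow> real) \<Rightarrow> 'v measure \<Rightarrow> ('v \<Rightarrow> 's measure) \<Rightarrow> bool"
  where "instance_distribution M f Q P \<longleftrightarrow>
    prob_space Q \<and> P \<in> measurable Q (prob_algebra M) \<and>
    (\<forall>v\<in>space Q. \<forall>x. integrable (P v) (f x))"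

text \<open>
  A method maps the number of samples \<open>n\<close>, the sample objective, the internal randomness \<open>u\<close> and
  the samples \<open>s 1, \<dots>, s n\<close> to its output.
\<close>

type_synonym ('x, 's) method_map =
  "nat \<Rightarrow> ('x \<Rightarrow> 's \<Rightarrow> real) \<Rightarrow> real \<times> (nat \<Rightarrow> 's) \<Rightarrow> 'x"

definition stochastic_method :: "'s measure \<Rightarrow> ('x::topological_space, 's) method_map \<Rightarrow> bool"
  where "stochastic_method M A \<longleftrightarrow>
    (\<forall>n f. A n f \<in> measurable (borel \<Otimes>\<^sub>M (\<Pi>\<^sub>M i\<in>{1..n}. M)) borel)"

text \<open>
  The expectation over \<open>V\<close>, the internal randomness and the samples (i.i.d. given \<open>V\<close>). It is a
  nonnegative integral, so an excess that is not integrable has expectation \<open>\<infinity>\<close>; the excess is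
  nonnegative whenever \<^term>\<open>argmin_set (objective f (P v))\<close> is nonempty, so nothing is truncated.
\<close>

definition expected_excess ::
    "('x \<Rightarrow> 's \<Rightarrow> real) \<Rightarrow> 'v measure \<Rightarrow> ('v \<Rightarrow> 's measure) \<Rightarrow> ('x, 's) method_map \<Rightarrow> nat \<Rightarrow> ennreal"
  where "expected_excess f Q P A n =
    (\<integral>\<^sup>+v. (\<integral>\<^sup>+\<omega>. ennreal (objective f (P v) (A n f \<omega>) - min_objective f (P v))
             \<partial>(uniform_measure lborel {0..1} \<Otimes>\<^sub>M (\<Pi>\<^sub>M i\<in>{1..n}. P v))) \<partial>Q)"

end

theory Submission
  imports Defs
begin

text \<open>
  The samples are signs with mean \<open>V\<close> and the sample objective is \<open>\<bar>x - s\<bar>\<close>, so that the minimizer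
  is the sign of \<open>V\<close> and any point has excess at least \<open>\<bar>V\<bar>\<close> for one of the two signs of \<open>V\<close>. With
  probability \<open>2\<^sup>-\<^sup>k\<^sup>-\<^sup>2\<close> each, \<open>V\<close> equals \<open>\<plusminus>1 / (2 \<surd>n\<^sub>k)\<close>; after \<open>n\<^sub>k\<close> samples this sign is
  undecided with constant probability, by Le Cam's two-point method. Hence the expected excess after
  \<open>n\<^sub>k\<close> samples is at least a constant times \<open>2\<^sup>-\<^sup>k / \<surd>n\<^sub>k\<close>, and choosing \<open>n\<^sub>k\<close> so large that
  \<open>\<rho> n\<^sub>k \<le> 2\<^sup>-\<^sup>k\<^sup>-\<^sup>5\<close> gives an upper limit of at least \<open>1\<close>.
\<close>

section \<open>Product densities and the overlap of two densities\<close>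

text \<open>Both measures agree on boxes: there the indicator factorizes just like the density, so
  the integral splits into one-dimensional ones.\<close>

lemma PiM_density:
  fixes M :: "'i \<Rightarrow> 'a measure"
  assumes "finite I"
    and M: "\<And>i. sigma_finite_measure (M i)"
    and D: "\<And>i. sigma_finite_measure (density (M i) (d i))"
    and d [measurable]: "\<And>i. d i \<in> borel_measurable (M i)"
  shows "(\<Pi>\<^sub>M i\<in>I. density (M i) (d i)) = density (\<Pi>\<^sub>M i\<in>I. M i) (\<lambda>x. \<Prod>i\<in>I. d i (x i))"
proof -
  interpret M: product_sigma_finite M
    by (rule product_sigma_finite.intro) (rule M)
  interpret D: product_sigma_finite "\<lambda>i. density (M i) (d i)"
    by (rule product_sigma_finite.intro) (rule D)
  show ?thesis
  proof (rule D.PiM_eqI[symmetric])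
    show "sets (density (Pi\<^sub>M I M) (\<lambda>x. \<Prod>i\<in>I. d i (x i))) = sets (\<Pi>\<^sub>M i\<in>I. density (M i) (d i))"
      by (simp cong: sets_PiM_cong)
  next
    fix A assume "\<And>i. i \<in> I \<Longrightarrow> A i \<in> sets (density (M i) (d i))"
    then have A [measurable]: "\<And>i. i \<in> I \<Longrightarrow> A i \<in> sets (M i)"
      by simp
    have "emeasure (density (Pi\<^sub>M I M) (\<lambda>x. \<Prod>i\<in>I. d i (x i))) (Pi\<^sub>E I A)
      = (\<integral>\<^sup>+x. (\<Prod>i\<in>I. d i (x i)) * indicator (Pi\<^sub>E I A) x \<partial>Pi\<^sub>M I M)"
      using \<open>finite I\<close> by (intro emeasure_density) (auto intro!: sets_PiM_I_finite)
    also have "\<dots> = (\<integral>\<^sup>+x. (\<Prod>i\<in>I. d i (x i) * indicator (A i) (x i)) \<partial>Pi\<^sub>M I M)"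
    proof (rule nn_integral_cong)
      fix x assume "x \<in> space (Pi\<^sub>M I M)"
      then have "indicator (Pi\<^sub>E I A) x = (\<Prod>i\<in>I. indicator (A i) (x i) :: ennreal)"
        using \<open>finite I\<close> by (auto simp: indicator_def space_PiM PiE_iff prod_zero_iff)
      then show "(\<Prod>i\<in>I. d i (x i)) * indicator (Pi\<^sub>E I A) x
          = (\<Prod>i\<in>I. d i (x i) * indicator (A i) (x i))"
        by (simp add: prod.distrib)
    qed
    also have "\<dots> = (\<Prod>i\<in>I. \<integral>\<^sup>+x. d i x * indicator (A i) x \<partial>M i)"
      using \<open>finite I\<close> by (intro M.product_nn_integral_prod) auto
    also have "\<dots> = (\<Prod>i\<in>I. emeasure (density (M i) (d i)) (A i))"
      by (intro prod.cong refl) (simp add: emeasure_density)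
    finally show "emeasure (density (Pi\<^sub>M I M) (\<lambda>x. \<Prod>i\<in>I. d i (x i))) (Pi\<^sub>E I A)
      = (\<Prod>i\<in>I. emeasure (density (M i) (d i)) (A i))" .
  qed (rule \<open>finite I\<close>)
qed

text \<open>
  Bounds the overlap \<open>\<integral> min p q\<close> of two densities in terms of their affinity \<open>\<integral> \<surd>(p q)\<close>,
  which factorizes over product measures.
\<close>

lemma sqrt_mult_le_min:
  fixes p q :: real
  assumes "0 \<le> p" "0 \<le> q"
  shows "sqrt (p * q) / 2 \<le> min p q + (p + q) / 16"
proof -
  have "sqrt (p * q) = sqrt (min p q) * sqrt (max p q)"
    by (simp add: real_sqrt_mult min_def max_def)
  \<comment> \<open>Weighted AM-GM. The weight 1/4 makes the error term p/16 + q/16, which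
    integrates to 1/8 for probability densities and so stays below half of an affinity of
    1/2.\<close>
  moreover have "0 \<le> (sqrt (min p q) - sqrt (max p q) / 4)\<^sup>2"
    by (rule zero_le_power2)
  moreover have "(sqrt (min p q))\<^sup>2 = min p q" "(sqrt (max p q))\<^sup>2 = max p q"
    using assms by simp_all
  moreover have "max p q \<le> p + q"
    using assms by simp
  ultimately show ?thesis
    unfolding power2_diff power_divide by (simp add: field_simps del: max.bounded_iff)
qed

lemma ennreal_sqrt_mult_le_min:
  fixes p q :: real
  assumes "0 \<le> p" "0 \<le> q"
  shows "ennreal (1 / 2) * ennreal (sqrt (p * q))
    \<le> min (ennreal p) (ennreal q) + ennreal (1 / 16) * (ennreal p + ennreal q)"
proof -
  have "ennreal (1 / 2) * ennreal (sqrt (p * q)) = ennreal (1 / 2 * sqrt (p * q))"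
    using assms by (intro ennreal_mult[symmetric]) auto
  also have "\<dots> \<le> ennreal (min p q + 1 / 16 * (p + q))"
    using sqrt_mult_le_min[OF assms] by (intro ennreal_leI) simp
  also have "\<dots> = ennreal (min p q) + ennreal (1 / 16) * ennreal (p + q)"
    using assms by (subst ennreal_mult[symmetric]) (auto intro!: ennreal_plus)
  also have "\<dots> = min (ennreal p) (ennreal q) + ennreal (1 / 16) * (ennreal p + ennreal q)"
    using assms by (simp add: min_def)
  finally show ?thesis .
qed

lemma real_sqrt_prod: "sqrt (\<Prod>i\<in>I. f i) = (\<Prod>i\<in>I. sqrt (f i))"
  by (induction I rule: infinite_finite_induct) (simp_all add: real_sqrt_mult)

section \<open>Biased signs and the absolute deviation objective\<close>

definition rademacher_pmf :: "real pmf"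
  where "rademacher_pmf = pmf_of_set {-1, 1}"

lemma set_rademacher_pmf [simp]: "set_pmf rademacher_pmf = {-1, 1}"
  by (simp add: rademacher_pmf_def set_pmf_of_set)

lemma nn_integral_rademacher_pmf:
  "(\<integral>\<^sup>+s. g s \<partial>rademacher_pmf) = (g (-1) + g 1) / 2"
  unfolding rademacher_pmf_def by (subst nn_integral_pmf_of_set) auto

lemma integral_rademacher_pmf:
  fixes g :: "real \<Rightarrow> real"
  shows "(\<integral>s. g s \<partial>rademacher_pmf) = (g (-1) + g 1) / 2"
  unfolding rademacher_pmf_def by (subst integral_pmf_of_set) auto

text \<open>For |b| \<le> 1 this is the law on {-1, 1} with mean \<open>b\<close>. Writing it as a
  density against the fair sign gives all biases a common reference measure.\<close>

definition biased_sign :: "real \<Rightarrow> real measure"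
  where "biased_sign b = density rademacher_pmf (\<lambda>s. ennreal (1 + b * s))"

lemma sets_biased_sign [simp, measurable_cong]: "sets (biased_sign b) = UNIV"
  by (simp add: biased_sign_def)

lemma space_biased_sign [simp]: "space (biased_sign b) = UNIV"
  by (simp add: biased_sign_def)

lemma nn_integral_biased_sign_weight:
  assumes "\<bar>b\<bar> \<le> 1"
  shows "(\<integral>\<^sup>+s. ennreal (1 + b * s) \<partial>rademacher_pmf) = 1"
  using assms
  by (simp add: nn_integral_rademacher_pmf ennreal_plus[symmetric] del: ennreal_plus)

lemma prob_space_biased_sign:
  assumes "\<bar>b\<bar> \<le> 1"
  shows "prob_space (biased_sign b)"
  by (rule prob_spaceI)
    (simp add: biased_sign_def emeasure_density nn_integral_biased_sign_weight[OF assms])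

text \<open>Only the support {-1, 1} matters; elsewhere the weight may be negative.\<close>

lemma AE_biased_sign_weight:
  assumes "\<bar>b\<bar> \<le> 1"
  shows "AE s in rademacher_pmf. 0 \<le> 1 + b * s"
  using assms by (auto simp: AE_measure_pmf_iff)

lemma integrable_biased_sign:
  fixes g :: "real \<Rightarrow> real"
  assumes "\<bar>b\<bar> \<le> 1"
  shows "integrable (biased_sign b) g"
  unfolding biased_sign_def
  by (subst integrable_density)
    (auto intro!: integrable_measure_pmf_finite AE_biased_sign_weight[OF assms])

lemma objective_biased_sign:
  assumes "\<bar>b\<bar> \<le> 1"
  shows "objective (\<lambda>x s. \<bar>x - s\<bar>) (biased_sign b) x
    = (1 + b) / 2 * \<bar>x - 1\<bar> + (1 - b) / 2 * \<bar>x + 1\<bar>"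
  unfolding objective_def biased_sign_def
  by (subst integral_density)
    (simp_all add: AE_biased_sign_weight[OF assms] integral_rademacher_pmf add_divide_distrib)

text \<open>Both weights (1 + b)/2 and (1 - b)/2 are at least (1 - |b|)/2, and the distances from
  \<open>x\<close> to 1 and -1 sum to at least 2.\<close>

lemma objective_biased_sign_ge:
  assumes "\<bar>b\<bar> \<le> 1"
  shows "1 - \<bar>b\<bar> \<le> objective (\<lambda>x s. \<bar>x - s\<bar>) (biased_sign b) x"
proof -
  have "(1 - \<bar>b\<bar>) / 2 * 2 \<le> (1 - \<bar>b\<bar>) / 2 * (\<bar>x - 1\<bar> + \<bar>x + 1\<bar>)"
    using assms by (intro mult_left_mono) auto
  also have "\<dots> = (1 - \<bar>b\<bar>) / 2 * \<bar>x - 1\<bar> + (1 - \<bar>b\<bar>) / 2 * \<bar>x + 1\<bar>"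
    by (rule distrib_left)
  also have "\<dots> \<le> (1 + b) / 2 * \<bar>x - 1\<bar> + (1 - b) / 2 * \<bar>x + 1\<bar>"
    by (intro add_mono mult_right_mono) auto
  finally show ?thesis
    using assms by (simp add: objective_biased_sign)
qed

lemma objective_biased_sign_minimizer:
  assumes "\<bar>b\<bar> \<le> 1"
  shows "objective (\<lambda>x s. \<bar>x - s\<bar>) (biased_sign b) (if 0 \<le> b then 1 else -1) = 1 - \<bar>b\<bar>"
  using assms by (simp add: objective_biased_sign)

lemma min_objective_biased_sign:
  assumes "\<bar>b\<bar> \<le> 1"
  shows "min_objective (\<lambda>x s. \<bar>x - s\<bar>) (biased_sign b) = 1 - \<bar>b\<bar>"
  unfolding min_objective_def
  by (intro cInf_eq_minimum)
    (use objective_biased_sign_ge[OF assms] in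
      \<open>auto simp flip: objective_biased_sign_minimizer[OF assms]\<close>)

lemma set_distance_biased_sign:
  assumes "\<bar>b\<bar> \<le> 1"
  shows "set_distance 0 (argmin_set (objective (\<lambda>x s. \<bar>x - s\<bar>) (biased_sign b))) \<le> 1"
proof -
  let ?x = "if 0 \<le> b then 1 else -1 :: real"
  have "?x \<in> argmin_set (objective (\<lambda>x s. \<bar>x - s\<bar>) (biased_sign b))"
    unfolding argmin_set_def is_arg_min_def mem_Collect_eq objective_biased_sign_minimizer[OF assms]
    using objective_biased_sign_ge[OF assms] by (simp add: not_less)
  then show ?thesis
    unfolding set_distance_def by (rule INF_lower2) simp
qed

section \<open>Le Cam's two-point bound\<close>

lemma borel_measurable_PiM_prod_pmf [measurable]:
  fixes p :: "'a pmf" and h :: "'a \<Rightarrow> ennreal"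
  shows "(\<lambda>s. \<Prod>i\<in>I. h (s i)) \<in> borel_measurable (\<Pi>\<^sub>M i\<in>I. measure_pmf p)"
  by (rule borel_measurable_prod_ennreal)
    (rule measurable_compose[OF measurable_component_singleton], auto)

text \<open>Change of measure to fair signs, under which the likelihoods of biases \<open>b\<close>
  and \<open>-b\<close> can be compared sample by sample.\<close>

lemma nn_integral_PiM_biased_sign:
  assumes b: "\<bar>b\<bar> \<le> 1" and "finite I"
    and g [measurable]: "g \<in> borel_measurable (\<Pi>\<^sub>M i\<in>I. rademacher_pmf)"
  shows "(\<integral>\<^sup>+s. g s \<partial>(\<Pi>\<^sub>M i\<in>I. biased_sign b))
    = (\<integral>\<^sup>+s. (\<Prod>i\<in>I. ennreal (1 + b * s i)) * g s \<partial>(\<Pi>\<^sub>M i\<in>I. rademacher_pmf))"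
proof -
  interpret B: prob_space "biased_sign b"
    by (rule prob_space_biased_sign[OF b])
  have "(\<Pi>\<^sub>M i\<in>I. biased_sign b)
    = density (\<Pi>\<^sub>M i\<in>I. rademacher_pmf) (\<lambda>s. \<Prod>i\<in>I. ennreal (1 + b * s i))"
    using \<open>finite I\<close> B.sigma_finite_measure_axioms unfolding biased_sign_def
    by (intro PiM_density) (auto intro: measure_pmf.sigma_finite_measure_axioms)
  then show ?thesis
    using borel_measurable_PiM_prod_pmf[of "\<lambda>s. ennreal (1 + b * s)" I rademacher_pmf]
    by (simp add: nn_integral_density)
qed

text \<open>The affinity of the two likelihoods factorizes into n equal factors
  \<open>sqrt (1 - b^2)\<close>. It stays at least 1/2 as long as n b^2 is small, and a large
  affinity forces a large overlap.\<close>

lemma min_likelihood_ge: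
  fixes b :: real
  assumes "0 \<le> b" "b \<le> 1" "real n * b\<^sup>2 \<le> 1 / 4"
  shows "ennreal (1 / 8) \<le> (\<integral>\<^sup>+s. min (\<Prod>i=1..n. ennreal (1 + b * s i)) (\<Prod>i=1..n. ennreal (1 - b * s i))
    \<partial>(\<Pi>\<^sub>M i\<in>{1..n}. rademacher_pmf))" (is "_ \<le> (\<integral>\<^sup>+s. min (?p s) (?q s) \<partial>?R)")
proof -
  interpret R: product_sigma_finite "\<lambda>_::nat. measure_pmf rademacher_pmf"
    by (rule product_sigma_finite.intro) (rule measure_pmf.sigma_finite_measure_axioms)
  let ?r = "\<lambda>s. \<Prod>i=1..n. ennreal (sqrt ((1 + b * s i) * (1 - b * s i)))"
  have p: "(\<integral>\<^sup>+s. ?p s \<partial>?R) = 1"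
    using nn_integral_biased_sign_weight[of b] assms
    by (subst R.product_nn_integral_prod) auto
  have q: "(\<integral>\<^sup>+s. ?q s \<partial>?R) = 1"
    using nn_integral_biased_sign_weight[of "-b"] assms
    by (subst R.product_nn_integral_prod) auto
  have "(\<integral>\<^sup>+s. ?r s \<partial>?R) = ennreal (sqrt (1 - b\<^sup>2)) ^ n"
  proof -
    have "(\<integral>\<^sup>+s. ennreal (sqrt ((1 + b * s) * (1 - b * s))) \<partial>rademacher_pmf)
        = (ennreal (sqrt (1 - b\<^sup>2)) + ennreal (sqrt (1 - b\<^sup>2))) / 2"
      unfolding nn_integral_rademacher_pmf by (simp add: algebra_simps power2_eq_square)
    also have "\<dots> = ennreal (sqrt (1 - b\<^sup>2))"
      using assms by (simp add: abs_square_le_1 flip: ennreal_plus)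
        (simp flip: ennreal_numeral add: divide_ennreal abs_square_le_1)
    finally show ?thesis
      by (subst R.product_nn_integral_prod) auto
  qed
  also have "\<dots> = ennreal (sqrt ((1 - b\<^sup>2) ^ n))"
    using assms by (simp add: ennreal_power real_sqrt_power abs_square_le_1)
  finally have r: "(\<integral>\<^sup>+s. ?r s \<partial>?R) = ennreal (sqrt ((1 - b\<^sup>2) ^ n))" .
  \<comment> \<open>Bernoulli gives 1 - n b^2, which is at least 3/4; the weaker 1/4 is enough and
    has the convenient root 1/2.\<close>
  have "1 / 4 \<le> (1 - b\<^sup>2) ^ n"
    using Bernoulli_inequality[of "- b\<^sup>2" n] assms by (simp add: abs_square_le_1)
  then have "sqrt ((1 / 2)\<^sup>2) \<le> sqrt ((1 - b\<^sup>2) ^ n)"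
    by (intro real_sqrt_le_mono) (simp add: power2_eq_square)
  then have r_ge: "1 / 2 \<le> sqrt ((1 - b\<^sup>2) ^ n)"
    by simp
  \<comment> \<open>On sign vectors all factors are nonnegative, so \<open>ennreal\<close> truncates
    nothing and commutes with the products.\<close>
  have AE: "AE s in ?R. \<forall>i\<in>{1..n}. s i \<in> {-1, 1}"
    using AE_measure_pmf[of rademacher_pmf]
    by (intro AE_finite_allI AE_PiM_component) (auto intro: measure_pmf.prob_space_axioms)
  have "AE s in ?R. ennreal (1 / 2) * ?r s \<le> min (?p s) (?q s) + ennreal (1 / 16) * (?p s + ?q s)"
    using AE
  proof eventually_elim
    case (elim s)
    have pos: "0 \<le> 1 + b * s i" "0 \<le> 1 - b * s i" if "i \<in> {1..n}" for i
      using elim[rule_format, OF that] assms by auto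
    let ?p' = "\<Prod>i=1..n. 1 + b * s i" and ?q' = "\<Prod>i=1..n. 1 - b * s i"
    have nonneg: "0 \<le> ?p'" "0 \<le> ?q'"
      using pos by (auto intro!: prod_nonneg)
    have "?p s = ennreal ?p'" "?q s = ennreal ?q'"
      using pos by (auto intro!: prod_ennreal)
    moreover have "?r s = ennreal (sqrt (?p' * ?q'))"
      using pos by (subst prod_ennreal) (auto simp flip: prod.distrib real_sqrt_prod)
    ultimately show ?case
      using ennreal_sqrt_mult_le_min[OF nonneg] by (simp only:)
  qed
  then have "(\<integral>\<^sup>+s. ennreal (1 / 2) * ?r s \<partial>?R)
    \<le> (\<integral>\<^sup>+s. min (?p s) (?q s) + ennreal (1 / 16) * (?p s + ?q s) \<partial>?R)"
    by (rule nn_integral_mono_AE)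
  then have affinity: "ennreal (1 / 2) * ennreal (sqrt ((1 - b\<^sup>2) ^ n))
    \<le> (\<integral>\<^sup>+s. min (?p s) (?q s) \<partial>?R) + ennreal (1 / 16) * (1 + 1)"
    by (simp add: nn_integral_add nn_integral_cmult p q r del: One_nat_def)
  \<comment> \<open>Half the affinity bound, 1/4, is split so that one 1/8 cancels the error term
    (1/16)(1 + 1) and the other remains.\<close>
  have "ennreal (1 / 8) + ennreal (1 / 8) = ennreal (1 / 2) * ennreal (1 / 2)"
    by (subst ennreal_mult[symmetric]; simp flip: ennreal_plus)
  also have "\<dots> \<le> ennreal (1 / 2) * ennreal (sqrt ((1 - b\<^sup>2) ^ n))"
    using r_ge by (intro mult_left_mono ennreal_leI) auto
  also note affinity
  also have "ennreal (1 / 16) * (1 + 1) = ennreal (1 / 8)"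
    unfolding distrib_left by (simp flip: ennreal_plus)
  finally show ?thesis
    by (subst (asm) (2) add.commute) (simp only: ennreal_add_left_cancel_le, simp)
qed

text \<open>The inner integral of \<open>expected_excess\<close>, for one fixed sample law, so that
  the average over V can be treated separately.\<close>

definition excess_at ::
    "(real \<Rightarrow> real \<Rightarrow> real) \<Rightarrow> (real, real) method_map \<Rightarrow> nat \<Rightarrow> real measure \<Rightarrow> ennreal"
  where "excess_at f A n P = (\<integral>\<^sup>+\<omega>. ennreal (objective f P (A n f \<omega>) - min_objective f P)
             \<partial>(uniform_measure lborel {0..1} \<Otimes>\<^sub>M (\<Pi>\<^sub>M i\<in>{1..n}. P)))"

text \<open>The output depends on the randomness and the samples only, not on the sign of the bias.
  Every output has total excess at least 2b over the two biases; multiplying by the overlap 1/8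
  gives b/4.\<close>

lemma two_point_lower_bound:
  fixes b :: real
  defines "f \<equiv> \<lambda>x s. \<bar>x - s\<bar>"
  assumes b: "0 \<le> b" "b \<le> 1" "real n * b\<^sup>2 \<le> 1 / 4"
    and A: "A n f \<in> measurable (borel \<Otimes>\<^sub>M (\<Pi>\<^sub>M i\<in>{1..n}. count_space UNIV)) borel"
  shows "ennreal (b / 4) \<le> excess_at f A n (biased_sign b) + excess_at f A n (biased_sign (- b))"
proof -
  let ?U = "uniform_measure lborel {0..1::real}"
  let ?R = "\<Pi>\<^sub>M i\<in>{1..n}. measure_pmf rademacher_pmf"
  let ?G = "\<lambda>c x. ennreal (objective f (biased_sign c) x - min_objective f (biased_sign c))"
  let ?w = "\<lambda>c s. \<Prod>i=1..n. ennreal (1 + c * s i)"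
  interpret U: prob_space ?U
    by (rule prob_space_uniform_measure) auto
  interpret R: product_sigma_finite "\<lambda>_::nat. measure_pmf rademacher_pmf"
    by (rule product_sigma_finite.intro) (rule measure_pmf.sigma_finite_measure_axioms)
  \<comment> \<open>Passing to the uniform law and to the discrete fair signs leaves the
    sigma-algebra unchanged, so measurability of the method carries over.\<close>
  have sets_eq: "sets (?U \<Otimes>\<^sub>M ?R) = sets (borel \<Otimes>\<^sub>M (\<Pi>\<^sub>M i\<in>{1..n}. count_space (UNIV :: real set)))"
    by (intro sets_pair_measure_cong sets_PiM_cong) auto
  have A' [measurable]: "A n f \<in> measurable (?U \<Otimes>\<^sub>M ?R) borel"
    using A by (simp cong: measurable_cong_sets add: measurable_cong_sets[OF sets_eq refl])
  have G [measurable]: "?G c \<in> borel_measurable borel" if "\<bar>c\<bar> \<le> 1" for c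
    using that by (simp add: f_def objective_biased_sign)
  have excess: "excess_at f A n (biased_sign c) = (\<integral>\<^sup>+u. \<integral>\<^sup>+s. ?w c s * ?G c (A n f (u, s)) \<partial>?R \<partial>?U)"
    if c: "\<bar>c\<bar> \<le> 1" for c
  proof -
    note G[OF c, measurable]
    let ?P = "\<Pi>\<^sub>M i\<in>{1..n}. biased_sign c"
    interpret B: product_prob_space "\<lambda>_::nat. biased_sign c" "{1..n}"
      by (intro product_prob_spaceI prob_space_biased_sign c)
    have sets_P: "sets (?U \<Otimes>\<^sub>M ?P) = sets (?U \<Otimes>\<^sub>M ?R)"
      by (intro sets_pair_measure_cong sets_PiM_cong) auto
    have "(\<lambda>\<omega>. ?G c (A n f \<omega>)) \<in> borel_measurable (?U \<Otimes>\<^sub>M ?R)"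
      by measurable
    then have "(\<lambda>\<omega>. ?G c (A n f \<omega>)) \<in> borel_measurable (?U \<Otimes>\<^sub>M ?P)"
      unfolding measurable_cong_sets[OF sets_P refl] .
    then have "excess_at f A n (biased_sign c) = (\<integral>\<^sup>+u. \<integral>\<^sup>+s. ?G c (A n f (u, s)) \<partial>?P \<partial>?U)"
      unfolding excess_at_def by (rule B.nn_integral_fst[symmetric])
    also have "\<dots> = (\<integral>\<^sup>+u. \<integral>\<^sup>+s. ?w c s * ?G c (A n f (u, s)) \<partial>?R \<partial>?U)"
      by (intro nn_integral_cong nn_integral_PiM_biased_sign c) measurable
    finally show ?thesis .
  qed
  have joint: "(\<lambda>(u, s). ?w c s * ?G c (A n f (u, s))) \<in> borel_measurable (?U \<Otimes>\<^sub>M ?R)"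
    if c: "\<bar>c\<bar> \<le> 1" for c
  proof -
    note G[OF c, measurable]
    have "(\<lambda>\<omega>. ?w c (snd \<omega>)) \<in> borel_measurable (?U \<Otimes>\<^sub>M ?R)"
      by (rule measurable_compose[OF measurable_snd borel_measurable_PiM_prod_pmf])
    then show ?thesis
      unfolding case_prod_beta prod.collapse by (rule borel_measurable_times_ennreal) measurable
  qed
  have b1: "\<bar>b\<bar> \<le> 1" "\<bar>- b\<bar> \<le> 1"
    using b by auto
  note [measurable] = G[OF b1(1)] G[OF b1(2)]
  \<comment> \<open>The two objectives add up to |x - 1| + |x + 1| \<ge> 2, while their minima add
    up to 2 - 2b.\<close>
  have sum_G: "ennreal (2 * b) \<le> ?G b x + ?G (- b) x" for x
  proof -
    have "2 * b \<le> (objective f (biased_sign b) x - min_objective f (biased_sign b))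
      + (objective f (biased_sign (- b)) x - min_objective f (biased_sign (- b)))"
      using b b1 abs_triangle_ineq4[of "x + 1" "x - 1"] unfolding f_def
      by (simp add: objective_biased_sign min_objective_biased_sign field_simps)
    then show ?thesis
      using objective_biased_sign_ge[OF b1(1)] objective_biased_sign_ge[OF b1(2)] b1
      unfolding f_def
      by (simp add: min_objective_biased_sign ennreal_leI flip: ennreal_plus)
  qed
  \<comment> \<open>Each likelihood is bounded below by their minimum; the same \<open>x\<close>
    serves both biases, as it will be the output on the same \<open>u\<close> and
    \<open>s\<close>.\<close>
  have pointwise: "ennreal (2 * b) * min (?w b s) (?w (- b) s)
      \<le> ?w b s * ?G b x + ?w (- b) s * ?G (- b) x" for x s
  proof -
    have "ennreal (2 * b) * min (?w b s) (?w (- b) s)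
      \<le> (?G b x + ?G (- b) x) * min (?w b s) (?w (- b) s)"
      by (intro mult_right_mono sum_G) simp
    also have "\<dots> \<le> ?w b s * ?G b x + ?w (- b) s * ?G (- b) x"
      by (subst distrib_right) (intro add_mono, auto simp: mult.commute intro!: mult_left_mono)
    finally show ?thesis .
  qed
  have "ennreal (b / 4) = ennreal (2 * b) * ennreal (1 / 8)"
    using b by (simp flip: ennreal_mult)
  also have "\<dots> \<le> ennreal (2 * b) * (\<integral>\<^sup>+s. min (?w b s) (?w (- b) s) \<partial>?R)"
    using min_likelihood_ge[OF b] by (intro mult_left_mono) auto
  also have "\<dots> = (\<integral>\<^sup>+u. \<integral>\<^sup>+s. ennreal (2 * b) * min (?w b s) (?w (- b) s) \<partial>?R \<partial>?U)"
    by (simp add: nn_integral_cmult U.emeasure_space_1)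
  also have "\<dots> \<le> (\<integral>\<^sup>+u. \<integral>\<^sup>+s. ?w b s * ?G b (A n f (u, s)) + ?w (- b) s * ?G (- b) (A n f (u, s)) \<partial>?R \<partial>?U)"
    by (intro nn_integral_mono pointwise)
  also have "\<dots> = (\<integral>\<^sup>+u. (\<integral>\<^sup>+s. ?w b s * ?G b (A n f (u, s)) \<partial>?R)
      + (\<integral>\<^sup>+s. ?w (- b) s * ?G (- b) (A n f (u, s)) \<partial>?R) \<partial>?U)"
    by (intro nn_integral_cong nn_integral_add borel_measurable_times_ennreal
        borel_measurable_PiM_prod_pmf) measurable
  also have "\<dots> = excess_at f A n (biased_sign b) + excess_at f A n (biased_sign (- b))"
    unfolding excess[OF b1(1)] excess[OF b1(2)]
    by (intro nn_integral_add sigma_finite_measure.borel_measurable_nn_integral joint b1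
        R.sigma_finite) auto
  finally show ?thesis .
qed

section \<open>The prior on the bias and the choice of sample sizes\<close>

text \<open>The space of a pmf measure is the whole type, so indices of probability zero must yield
  valid instances too. Values in [-1, 1] are unchanged.\<close>

definition clamp1 :: "real \<Rightarrow> real"
  where "clamp1 v = max (-1) (min 1 v)"

text \<open>All other atoms contribute nonnegatively and are dropped; distinctness keeps one atom
  from being counted twice.\<close>

lemma nn_integral_pmf_ge_two_points:
  fixes p :: "'a pmf"
  assumes "x \<noteq> y" "w \<le> pmf p x" "w \<le> pmf p y"
  shows "ennreal w * (g x + g y) \<le> (\<integral>\<^sup>+v. g v \<partial>p)"
proof -
  have "ennreal w * (g x + g y) \<le> g x * ennreal (pmf p x) + g y * ennreal (pmf p y)"
    unfolding distrib_left using assms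
    by (subst (1 2) mult.commute) (intro add_mono mult_left_mono ennreal_leI; simp)
  also have "\<dots> = (\<integral>\<^sup>+v. g x * indicator {x} v + g y * indicator {y} v \<partial>p)"
    by (subst nn_integral_add) (auto simp: nn_integral_cmult_indicator emeasure_pmf_single)
  also have "\<dots> \<le> (\<integral>\<^sup>+v. g v \<partial>p)"
    using \<open>x \<noteq> y\<close> by (intro nn_integral_mono) (auto simp: indicator_def)
  finally show ?thesis .
qed

definition signed_scale_pmf :: "(nat \<Rightarrow> real) \<Rightarrow> real pmf"
  where "signed_scale_pmf e = map_pmf (\<lambda>(k, s). s * e k) (pair_pmf (geometric_pmf (1 / 2)) rademacher_pmf)"

text \<open>The scale \<open>k\<close> has mass 2^(-k-1) and the sign has mass 1/2. Equality may
  fail, since different pairs can have the same product.\<close>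

lemma pmf_signed_scale_pmf_ge:
  assumes "s \<in> {-1, 1}"
  shows "(1 / 2) ^ (k + 2) \<le> pmf (signed_scale_pmf e) (s * e k)"
proof -
  have "(1 / 2) ^ (k + 2) = pmf (pair_pmf (geometric_pmf (1 / 2)) rademacher_pmf) (k, s)"
    using assms by (auto simp: pmf_pair rademacher_pmf_def pmf_of_set)
  also have "\<dots> \<le> pmf (signed_scale_pmf e) (s * e k)"
    unfolding signed_scale_pmf_def pmf_map
    by (subst measure_pmf_single[symmetric], intro measure_pmf.finite_measure_mono) auto
  finally show ?thesis .
qed

text \<open>Surjectivity provides a real point with value \<open>w\<close>, and monotonicity carries
  the bound to any larger integer, in particular to one beyond \<open>k\<close>.\<close>

lemma ex_small_value:
  fixes \<rho> :: "real \<Rightarrow> real"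
  assumes "bij_betw \<rho> {1..} {0<..1}" "antimono_on {1..} \<rho>" "0 < w" "w \<le> 1"
  shows "\<exists>n::nat. 1 \<le> n \<and> k \<le> n \<and> 0 < \<rho> (real n) \<and> \<rho> (real n) \<le> w"
proof -
  have "w \<in> \<rho> ` {1..}"
    using assms by (auto simp: bij_betw_def)
  then obtain t where t: "1 \<le> t" "\<rho> t = w"
    by auto
  define n where "n = max k (nat \<lceil>t\<rceil>)"
  have n: "t \<le> real n"
    unfolding n_def by linarith
  then have "\<rho> (real n) \<le> w"
    using assms(2) t by (auto simp: monotone_on_def)
  moreover have "\<rho> (real n) \<in> {0<..1}"
    using assms(1) t n by (intro bij_betwE[OF assms(1), rule_format]) auto
  moreover have "1 \<le> n"
    using t n by linarith
  ultimately show ?thesis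
    by (intro exI[of _ n]) (auto simp: n_def)
qed

theorem corollary5:
  fixes \<rho> :: "real \<Rightarrow> real"
  assumes "bij_betw \<rho> {1..} {0<..1}"
    and "antimono_on {1..} \<rho>"
  shows "\<exists>(M :: real measure) (f :: real \<Rightarrow> real \<Rightarrow> real) (Q :: real measure) (P :: real \<Rightarrow> real measure).
    instance_distribution M f Q P \<and>
    (\<forall>v\<in>space Q. set_distance 0 (argmin_set (objective f (P v))) \<le> 1) \<and>
    (\<forall>s\<in>space M. convex_on UNIV (\<lambda>x. f x s) \<and> 1-lipschitz_on UNIV (\<lambda>x. f x s)) \<and>
    (\<forall>A. stochastic_method M A \<longrightarrow>
      limsup (\<lambda>n. ennreal (sqrt (real n)) * expected_excess f Q P A n / ennreal (\<rho> (real n)))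
        \<ge> ennreal (1 / 6))"
proof -
  \<comment> \<open>The factor 1/8 matches the scaled excess at scale \<open>k\<close>, which is at
    least the atom's mass 2^(-k-2) divided by 8.\<close>
  have "\<exists>n::nat. 1 \<le> n \<and> k \<le> n \<and> 0 < \<rho> (real n) \<and> \<rho> (real n) \<le> (1 / 2) ^ (k + 2) / 8" for k
    using ex_small_value[OF assms, of "(1 / 2) ^ (k + 2) / 8"]
      power_le_one[of "1 / 2 :: real" "k + 2"] by auto
  then obtain N where N: "\<And>k. 1 \<le> N k" "\<And>k. k \<le> N k" "\<And>k. 0 < \<rho> (real (N k))"
    "\<And>k. \<rho> (real (N k)) \<le> (1 / 2) ^ (k + 2) / 8"
    by metis
  \<comment> \<open>The largest bias allowed by the two-point bound: \<open>N k\<close> times its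
    square is exactly 1/4.\<close>
  define e where "e k = 1 / (2 * sqrt (real (N k)))" for k
  have sqrt_N: "1 \<le> sqrt (real (N k))" for k
    using N(1)[of k] by simp
  have e: "0 < e k" "e k \<le> 1" "real (N k) * (e k)\<^sup>2 \<le> 1 / 4" for k
    using N(1)[of k] sqrt_N[of k] by (auto simp: e_def power_divide power_mult_distrib
      simp del: real_sqrt_ge_1_iff)
  let ?M = "count_space UNIV :: real measure"
  let ?f = "\<lambda>x s. \<bar>x - s\<bar> :: real"
  let ?Q = "measure_pmf (signed_scale_pmf e)"
  let ?P = "\<lambda>v. biased_sign (clamp1 v)"
  have clamp: "\<bar>clamp1 v\<bar> \<le> 1" for v
    by (auto simp: clamp1_def)
  have "instance_distribution ?M ?f ?Q ?P"
    unfolding instance_distribution_def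
    using prob_space_biased_sign[OF clamp] integrable_biased_sign[OF clamp]
    by (auto simp: measure_pmf.prob_space_axioms space_prob_algebra)
  moreover have "\<forall>v\<in>space ?Q. set_distance 0 (argmin_set (objective ?f (?P v))) \<le> 1"
    using set_distance_biased_sign[OF clamp] by simp
  moreover have "convex_on UNIV (\<lambda>x. ?f x s)" for s
    using convex_on_dist[of UNIV s] by (simp add: convex_on_def dist_real_def abs_minus_commute)
  moreover have "1-lipschitz_on UNIV (\<lambda>x. ?f x s)" for s
    by (auto simp: lipschitz_on_def dist_real_def)
  moreover have "ennreal (1 / 6)
      \<le> limsup (\<lambda>n. ennreal (sqrt (real n)) * expected_excess ?f ?Q ?P A n / ennreal (\<rho> (real n)))"
    if A: "stochastic_method ?M A" for A
    unfolding limsup_INF_SUP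
  proof (intro INF_greatest)
    \<comment> \<open>Every tail supremum from \<open>k\<close> on is bounded below by its term at
      \<open>N k\<close>, which lies in the tail because \<open>k \<le> N k\<close>.\<close>
    fix k :: nat
    let ?n = "N k" and ?w = "(1 / 2) ^ (k + 2) :: real"
    have two: "ennreal (e k / 4) \<le> excess_at ?f A ?n (?P (e k)) + excess_at ?f A ?n (?P (- e k))"
      using two_point_lower_bound[of "e k" ?n A] e[of k] A
      by (simp add: stochastic_method_def clamp1_def)
    have "ennreal ?w * ennreal (e k / 4)
      \<le> ennreal ?w * (excess_at ?f A ?n (?P (e k)) + excess_at ?f A ?n (?P (- e k)))"
      by (intro mult_left_mono two) auto
    also have "\<dots> \<le> (\<integral>\<^sup>+v. excess_at ?f A ?n (?P v) \<partial>?Q)"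
      using pmf_signed_scale_pmf_ge[of 1 k e] pmf_signed_scale_pmf_ge[of "-1" k e] e(1)[of k]
      by (intro nn_integral_pmf_ge_two_points) auto
    also have "\<dots> = expected_excess ?f ?Q ?P A ?n"
      by (simp add: expected_excess_def excess_at_def)
    finally have "ennreal (sqrt ?n) * (ennreal ?w * ennreal (e k / 4)) / ennreal (\<rho> ?n)
      \<le> ennreal (sqrt ?n) * expected_excess ?f ?Q ?P A ?n / ennreal (\<rho> ?n)"
      by (intro divide_right_mono_ennreal mult_left_mono) auto
    \<comment> \<open>The sample size cancels: \<open>sqrt ?n * e k / 4\<close> equals 1/8.\<close>
    moreover have "ennreal (sqrt ?n) * (ennreal ?w * ennreal (e k / 4)) / ennreal (\<rho> ?n)
      = ennreal (?w / 8 / \<rho> ?n)"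
      using N(1)[of k] N(3)[of k] e(1)[of k]
      by (simp add: e_def divide_ennreal flip: ennreal_mult)
    moreover have "ennreal (1 / 6) \<le> ennreal (?w / 8 / \<rho> ?n)"
    proof (rule ennreal_leI)
      have "1 \<le> ?w / 8 / \<rho> ?n"
        using N(3,4)[of k] by simp
      then show "1 / 6 \<le> ?w / 8 / \<rho> ?n"
        by linarith
    qed
    ultimately have "ennreal (1 / 6)
        \<le> ennreal (sqrt ?n) * expected_excess ?f ?Q ?P A ?n / ennreal (\<rho> ?n)"
      by simp
    then show "ennreal (1 / 6) \<le> (SUP n\<in>{k..}. ennreal (sqrt (real n)) * expected_excess ?f ?Q ?P A n
        / ennreal (\<rho> (real n)))"
      by (rule SUP_upper2[rotated]) (use N(2)[of k] in simp)
  qed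
  ultimately show ?thesis
    by (intro exI[of _ ?M] exI[of _ ?f] exI[of _ ?Q] exI[of _ ?P]) auto
qed

end
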